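(* Let $(M^n,g)$, $n\ge3$, be a nearly quasi-Einstein manifold $N(QE)_n$. If $(M,g)$ is conharmonically flat, i.e. the conharmonic curvature tensor satisfies $H(X,Y,Z,W)=0$ for all vector fields $X,Y,Z,W$, then $(M,g)$ is a manifold of nearly quasi-constant curvature $N(QC)_n$.
   Context: Let $(M^n,g)$ be a semi-Riemannian manifold with Riemann curvature $R(X,Y)Z$, $\tilde R(X,Y,Z,W)=g(R(X,Y)Z,W)$ and Ricci tensor $S$. The sign convention is the one in which constant curvature $c$ means $R(X,Y)Z=c[g(Y,Z)X-g(X,Z)Y]$, and $S(Y,Z)=\mathrm{trace}(X\mapsto R(X,Y)Z)$. A non-flat semi-Riemannian manifold $(M^n,g)$, $n\ge 3$, is a nearly quasi-Einstein manifold, denoted $N(QE)_n$, if $S(X,Y)=\alpha g(X,Y)+\beta D(X,Y)$ for scalar functions $\alpha,\beta$ with $\beta\neq0$ and a nonzero symmetric $(0,2)$ tensor $D$. The conharmonic curvature tensor is $$H(X,Y,Z,W)=\tilde R(X,Y,Z,W)-\tfrac{1}{n-2}[g(X,W)S(Y,Z)-g(X,Z)S(Y,W)+g(Y,Z)S(X,W)-g(Y,W)S(X,Z)].$$ $(M,g)$ is a manifold of nearly quasi-constant curvature, denoted $N(QC)_n$, if there are scalar functions $a,b$ and a nonzero symmetric $(0,2)$ tensor $E$ with $$\tilde R(X,Y,Z,W)=a[g(Y,Z)g(X,W)-g(X,Z)g(Y,W)]+b[g(X,W)E(Y,Z)-g(X,Z)E(Y,W)+g(Y,Z)E(X,W)-g(Y,W)E(X,Z)].$$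 *)

theory Defs
  imports "HOL-Analysis.Analysis"
begin

text \<open>The definitions of smoothness are meant for open sets \<open>S\<close> only.\<close>

primrec Ck_on :: "nat \<Rightarrow> 'e::real_normed_vector set \<Rightarrow> ('e \<Rightarrow> 'f::real_normed_vector) \<Rightarrow> bool" where
  "Ck_on 0 S f \<longleftrightarrow> continuous_on S f"
| "Ck_on (Suc k) S f \<longleftrightarrow>
     (\<forall>x\<in>S. f differentiable (at x)) \<and>
     (\<forall>v. Ck_on k S (\<lambda>x. frechet_derivative f (at x) v))"

definition smooth_on :: "'e::real_normed_vector set \<Rightarrow> ('e \<Rightarrow> 'f::real_normed_vector) \<Rightarrow> bool" where
  "smooth_on S f \<longleftrightarrow> (\<forall>k. Ck_on k S f)"

text \<open>
  The points of a manifold are the elements of a Hausdorff, second countable type \<open>'a\<close>; its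
  dimension is \<open>CARD('n)\<close>; its smooth structure is given by an atlas, a set of pairs of a
  chart domain and a chart map. The atlas need not be maximal.
\<close>

type_synonym ('a, 'n) atlas = "('a set \<times> ('a \<Rightarrow> real ^ 'n)) set"

definition smooth_manifold ::
    "('a::{t2_space, second_countable_topology}, 'n::finite) atlas \<Rightarrow> bool" where
  "smooth_manifold A \<longleftrightarrow>
     (\<Union>(U, \<phi>)\<in>A. U) = UNIV \<and>
     (\<forall>(U, \<phi>)\<in>A. open U \<and> open (\<phi> ` U) \<and> homeomorphism U (\<phi> ` U) \<phi> (inv_into U \<phi>)) \<and>
     (\<forall>(U, \<phi>)\<in>A. \<forall>(V, \<psi>)\<in>A. smooth_on (\<phi> ` (U \<inter> V)) (\<psi> \<circ> inv_into U \<phi>))"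

definition smooth_functions :: "('a, 'n::finite) atlas \<Rightarrow> ('a \<Rightarrow> real) set" where
  "smooth_functions A = {f. \<forall>(U, \<phi>)\<in>A. smooth_on (\<phi> ` U) (f \<circ> inv_into U \<phi>)}"

text \<open>
  Vector fields are the derivations of the algebra of smooth functions, \<open>X f p\<close> being the
  directional derivative of \<open>f\<close> along \<open>X\<close> at \<open>p\<close>. Since HOL functions are total, a derivation is
  set to zero on functions that are not smooth; equality of vector fields is then equality of
  HOL functions.
\<close>

type_synonym 'a vfield = "('a \<Rightarrow> real) \<Rightarrow> 'a \<Rightarrow> real"

definition vector_fields :: "('a, 'n::finite) atlas \<Rightarrow> 'a vfield set" where
  "vector_fields A = {X.
     (\<forall>f. f \<notin> smooth_functions A \<longrightarrow> X f = (\<lambda>p. 0)) \<and>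
     (\<forall>f\<in>smooth_functions A. X f \<in> smooth_functions A) \<and>
     (\<forall>f\<in>smooth_functions A. \<forall>h\<in>smooth_functions A.
        X (\<lambda>p. f p + h p) = (\<lambda>p. X f p + X h p)) \<and>
     (\<forall>f\<in>smooth_functions A. \<forall>c. X (\<lambda>p. c * f p) = (\<lambda>p. c * X f p)) \<and>
     (\<forall>f\<in>smooth_functions A. \<forall>h\<in>smooth_functions A.
        X (\<lambda>p. f p * h p) = (\<lambda>p. f p * X h p + h p * X f p))}"

definition vf_add :: "'a vfield \<Rightarrow> 'a vfield \<Rightarrow> 'a vfield" where
  "vf_add X Y = (\<lambda>f p. X f p + Y f p)"

definition vf_diff :: "'a vfield \<Rightarrow> 'a vfield \<Rightarrow> 'a vfield" where
  "vf_diff X Y = (\<lambda>f p. X f p - Y f p)"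

definition vf_scale :: "('a \<Rightarrow> real) \<Rightarrow> 'a vfield \<Rightarrow> 'a vfield" where
  "vf_scale u X = (\<lambda>f p. u p * X f p)"

definition lie_bracket :: "'a vfield \<Rightarrow> 'a vfield \<Rightarrow> 'a vfield" where
  "lie_bracket X Y = (\<lambda>f p. X (Y f) p - Y (X f) p)"

text \<open>
  A \<open>(0,2)\<close> tensor field is a map from pairs of vector fields to smooth functions that is bilinear
  over the smooth functions. Values on arguments that are not vector fields are irrelevant.
\<close>

type_synonym 'a tensor02 = "'a vfield \<Rightarrow> 'a vfield \<Rightarrow> 'a \<Rightarrow> real"

definition tensor_field02 :: "('a, 'n::finite) atlas \<Rightarrow> 'a tensor02 \<Rightarrow> bool" where
  "tensor_field02 A T \<longleftrightarrow>
     (\<forall>X\<in>vector_fields A. \<forall>Y\<in>vector_fields A. T X Y \<in> smooth_functions A) \<and>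
     (\<forall>X\<in>vector_fields A. \<forall>Y\<in>vector_fields A. \<forall>Z\<in>vector_fields A.
        T (vf_add X Y) Z = (\<lambda>p. T X Z p + T Y Z p) \<and>
        T Z (vf_add X Y) = (\<lambda>p. T Z X p + T Z Y p)) \<and>
     (\<forall>u\<in>smooth_functions A. \<forall>X\<in>vector_fields A. \<forall>Y\<in>vector_fields A.
        T (vf_scale u X) Y = (\<lambda>p. u p * T X Y p) \<and>
        T X (vf_scale u Y) = (\<lambda>p. u p * T X Y p))"

definition symmetric_tensor_field :: "('a, 'n::finite) atlas \<Rightarrow> 'a tensor02 \<Rightarrow> bool" where
  "symmetric_tensor_field A T \<longleftrightarrow>
     tensor_field02 A T \<and> (\<forall>X\<in>vector_fields A. \<forall>Y\<in>vector_fields A. T X Y = T Y X)"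

definition nonzero_tensor :: "('a, 'n::finite) atlas \<Rightarrow> 'a tensor02 \<Rightarrow> bool" where
  "nonzero_tensor A T \<longleftrightarrow> (\<exists>X\<in>vector_fields A. \<exists>Y\<in>vector_fields A. \<exists>p. T X Y p \<noteq> 0)"

text \<open>
  The index at \<open>p\<close> is the largest dimension of a subspace of the tangent space at \<open>p\<close> on which \<open>g\<close>
  is negative definite; \<open>X 0, \<dots>, X (k - 1)\<close> below restrict to a basis of such a subspace.
\<close>

definition metric_index :: "('a, 'n::finite) atlas \<Rightarrow> 'a tensor02 \<Rightarrow> 'a \<Rightarrow> nat" where
  "metric_index A g p = (GREATEST k. \<exists>X :: nat \<Rightarrow> 'a vfield.
     (\<forall>i<k. X i \<in> vector_fields A) \<and>
     (\<forall>c :: nat \<Rightarrow> real. (\<exists>i<k. c i \<noteq> 0) \<longrightarrow>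
        (\<Sum>i<k. \<Sum>j<k. c i * c j * g (X i) (X j) p) < 0))"

definition semi_riemannian_metric :: "('a, 'n::finite) atlas \<Rightarrow> 'a tensor02 \<Rightarrow> bool" where
  "semi_riemannian_metric A g \<longleftrightarrow>
     symmetric_tensor_field A g \<and>
     (\<forall>p. \<forall>X\<in>vector_fields A.
        (\<forall>Y\<in>vector_fields A. g X Y p = 0) \<longrightarrow> (\<forall>f. X f p = 0)) \<and>
     (\<exists>\<nu>. \<forall>p. metric_index A g p = \<nu>)"

definition semi_riemannian_manifold ::
    "('a::{t2_space, second_countable_topology}, 'n::finite) atlas \<Rightarrow> 'a tensor02 \<Rightarrow> bool" where
  "semi_riemannian_manifold A g \<longleftrightarrow> smooth_manifold A \<and> semi_riemannian_metric A g"

definition affine_connection ::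
    "('a, 'n::finite) atlas \<Rightarrow> ('a vfield \<Rightarrow> 'a vfield \<Rightarrow> 'a vfield) \<Rightarrow> bool" where
  "affine_connection A nabla \<longleftrightarrow>
     (\<forall>X\<in>vector_fields A. \<forall>Y\<in>vector_fields A. nabla X Y \<in> vector_fields A) \<and>
     (\<forall>X\<in>vector_fields A. \<forall>Y\<in>vector_fields A. \<forall>Z\<in>vector_fields A.
        nabla (vf_add X Y) Z = vf_add (nabla X Z) (nabla Y Z) \<and>
        nabla Z (vf_add X Y) = vf_add (nabla Z X) (nabla Z Y)) \<and>
     (\<forall>u\<in>smooth_functions A. \<forall>X\<in>vector_fields A. \<forall>Y\<in>vector_fields A.
        nabla (vf_scale u X) Y = vf_scale u (nabla X Y) \<and>
        nabla X (vf_scale u Y) = vf_add (vf_scale (X u) Y) (vf_scale u (nabla X Y)))"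

definition is_levi_civita ::
    "('a, 'n::finite) atlas \<Rightarrow> 'a tensor02 \<Rightarrow> ('a vfield \<Rightarrow> 'a vfield \<Rightarrow> 'a vfield) \<Rightarrow> bool" where
  "is_levi_civita A g nabla \<longleftrightarrow>
     affine_connection A nabla \<and>
     (\<forall>X\<in>vector_fields A. \<forall>Y\<in>vector_fields A.
        vf_diff (nabla X Y) (nabla Y X) = lie_bracket X Y) \<and>
     (\<forall>X\<in>vector_fields A. \<forall>Y\<in>vector_fields A. \<forall>Z\<in>vector_fields A.
        X (g Y Z) = (\<lambda>p. g (nabla X Y) Z p + g Y (nabla X Z) p))"

text \<open>
  By the fundamental theorem of semi-Riemannian geometry the Levi-Civita connection exists and
  is unique on vector fields; the choice only affects arguments that are not vector fields.
\<close>

definition levi_civita ::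
    "('a, 'n::finite) atlas \<Rightarrow> 'a tensor02 \<Rightarrow> 'a vfield \<Rightarrow> 'a vfield \<Rightarrow> 'a vfield" where
  "levi_civita A g = (SOME nabla. is_levi_civita A g nabla)"

definition riemann ::
    "('a, 'n::finite) atlas \<Rightarrow> 'a tensor02 \<Rightarrow> 'a vfield \<Rightarrow> 'a vfield \<Rightarrow> 'a vfield \<Rightarrow> 'a vfield" where
  "riemann A g X Y Z =
     (let nabla = levi_civita A g
      in vf_diff (vf_diff (nabla X (nabla Y Z)) (nabla Y (nabla X Z))) (nabla (lie_bracket X Y) Z))"

definition riemann04 ::
    "('a, 'n::finite) atlas \<Rightarrow> 'a tensor02 \<Rightarrow>
     'a vfield \<Rightarrow> 'a vfield \<Rightarrow> 'a vfield \<Rightarrow> 'a vfield \<Rightarrow> 'a \<Rightarrow> real" where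
  "riemann04 A g X Y Z W = g (riemann A g X Y Z) W"

definition flat :: "('a, 'n::finite) atlas \<Rightarrow> 'a tensor02 \<Rightarrow> bool" where
  "flat A g \<longleftrightarrow>
     (\<forall>X\<in>vector_fields A. \<forall>Y\<in>vector_fields A. \<forall>Z\<in>vector_fields A.
        riemann A g X Y Z = (\<lambda>f p. 0))"

text \<open>The values at \<open>p\<close> of the vector fields \<open>E i\<close> form a basis of the tangent space at \<open>p\<close>.\<close>

definition frame_at :: "('a, 'n::finite) atlas \<Rightarrow> 'a \<Rightarrow> ('n \<Rightarrow> 'a vfield) \<Rightarrow> bool" where
  "frame_at A p E \<longleftrightarrow>
     (\<forall>i. E i \<in> vector_fields A) \<and>
     (\<forall>X\<in>vector_fields A. \<exists>!c :: 'n \<Rightarrow> real. \<forall>f. X f p = (\<Sum>i\<in>UNIV. c i * E i f p))"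

text \<open>
  The trace at \<open>p\<close> of an endomorphism \<open>L\<close> of the module of vector fields that is linear over the
  smooth functions: \<open>L\<close> induces an endomorphism of the tangent space at \<open>p\<close>, whose matrix with
  respect to a basis is \<open>m\<close>. The sum of the diagonal entries does not depend on the basis.
\<close>

definition trace_at :: "('a, 'n::finite) atlas \<Rightarrow> ('a vfield \<Rightarrow> 'a vfield) \<Rightarrow> 'a \<Rightarrow> real" where
  "trace_at A L p = (THE t. \<exists>(E :: 'n \<Rightarrow> 'a vfield) (m :: 'n \<Rightarrow> 'n \<Rightarrow> real).
     frame_at A p E \<and>
     (\<forall>j f. L (E j) f p = (\<Sum>i\<in>UNIV. m i j * E i f p)) \<and>
     t = (\<Sum>i\<in>UNIV. m i i))"

definition ricci :: "('a, 'n::finite) atlas \<Rightarrow> 'a tensor02 \<Rightarrow> 'a tensor02" where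
  "ricci A g Y Z p = trace_at A (\<lambda>X. riemann A g X Y Z) p"

definition conharmonic ::
    "('a, 'n::finite) atlas \<Rightarrow> 'a tensor02 \<Rightarrow>
     'a vfield \<Rightarrow> 'a vfield \<Rightarrow> 'a vfield \<Rightarrow> 'a vfield \<Rightarrow> 'a \<Rightarrow> real" where
  "conharmonic A g X Y Z W p =
     riemann04 A g X Y Z W p -
     1 / (real CARD('n) - 2) *
       (g X W p * ricci A g Y Z p - g X Z p * ricci A g Y W p +
        g Y Z p * ricci A g X W p - g Y W p * ricci A g X Z p)"

definition conharmonically_flat :: "('a, 'n::finite) atlas \<Rightarrow> 'a tensor02 \<Rightarrow> bool" where
  "conharmonically_flat A g \<longleftrightarrow>
     (\<forall>X\<in>vector_fields A. \<forall>Y\<in>vector_fields A. \<forall>Z\<in>vector_fields A. \<forall>W\<in>vector_fields A.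
        \<forall>p. conharmonic A g X Y Z W p = 0)"

definition nearly_quasi_einstein ::
    "('a::{t2_space, second_countable_topology}, 'n::finite) atlas \<Rightarrow> 'a tensor02 \<Rightarrow> bool" where
  "nearly_quasi_einstein A g \<longleftrightarrow>
     semi_riemannian_manifold A g \<and> CARD('n) \<ge> 3 \<and> \<not> flat A g \<and>
     (\<exists>\<alpha>\<in>smooth_functions A. \<exists>\<beta>\<in>smooth_functions A. \<exists>D.
        \<beta> \<noteq> (\<lambda>p. 0) \<and> symmetric_tensor_field A D \<and> nonzero_tensor A D \<and>
        (\<forall>X\<in>vector_fields A. \<forall>Y\<in>vector_fields A. \<forall>p.
           ricci A g X Y p = \<alpha> p * g X Y p + \<beta> p * D X Y p))"

definition nearly_quasi_constant_curvature ::
    "('a::{t2_space, second_countable_topology}, 'n::finite) atlas \<Rightarrow> 'a tensor02 \<Rightarrow> bool" where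
  "nearly_quasi_constant_curvature A g \<longleftrightarrow>
     semi_riemannian_manifold A g \<and>
     (\<exists>a\<in>smooth_functions A. \<exists>b\<in>smooth_functions A. \<exists>E.
        symmetric_tensor_field A E \<and> nonzero_tensor A E \<and>
        (\<forall>X\<in>vector_fields A. \<forall>Y\<in>vector_fields A. \<forall>Z\<in>vector_fields A. \<forall>W\<in>vector_fields A. \<forall>p.
           riemann04 A g X Y Z W p =
             a p * (g Y Z p * g X W p - g X Z p * g Y W p) +
             b p * (g X W p * E Y Z p - g X Z p * E Y W p +
                    g Y Z p * E X W p - g Y W p * E X Z p)))"

end

theory Submission
  imports Defs
begin

text \<open>
  Conharmonic flatness expresses the curvature through \<open>g\<close> and \<open>S\<close>. Inserting
  \<open>S = \<alpha> g + \<beta> D\<close>, the \<open>g\<close>-part contributes twice the constant curvature expression, so that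
  \<open>a = 2 \<alpha> / (n - 2)\<close>, \<open>b = \<beta> / (n - 2)\<close> and \<open>E = D\<close>.
\<close>

text \<open>
  The equality is only assumed on \<open>S\<close>: Frechet derivatives outside \<open>S\<close> may be junk values, for
  which it is not inherited by the derivatives in the induction step.
\<close>

lemma Ck_on_scaleR_cong:
  fixes f h :: "'e::real_normed_vector \<Rightarrow> 'f::real_normed_vector"
  assumes "open S" and "Ck_on k S f" and "\<And>x. x \<in> S \<Longrightarrow> h x = c *\<^sub>R f x"
  shows "Ck_on k S h"
  using assms(2,3)
proof (induction k arbitrary: f h)
  case 0
  have "continuous_on S (\<lambda>x. c *\<^sub>R f x)"
    using 0 by (auto intro: continuous_intros)
  then show ?case
    using 0 by (simp cong: continuous_on_cong)
next
  case (Suc k)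
  have deriv: "(h has_derivative (\<lambda>v. c *\<^sub>R frechet_derivative f (at x) v)) (at x)"
    if "x \<in> S" for x
  \<comment> \<open>Since \<open>S\<close> is open, \<open>h\<close> equals the multiple of
    \<open>f\<close> on a neighbourhood of \<open>x\<close>, which fixes its derivative
    there.\<close>
  proof (rule has_derivative_transform_within_open[OF _ \<open>open S\<close> that])
    show "((\<lambda>y. c *\<^sub>R f y) has_derivative (\<lambda>v. c *\<^sub>R frechet_derivative f (at x) v)) (at x)"
      using Suc.prems(1) that
      by (auto intro: has_derivative_scaleR_right simp: frechet_derivative_works)
  qed (simp add: Suc.prems(2))
  \<comment> \<open>For each fixed direction \<open>v\<close>, the directional derivatives are again
    proportional on \<open>S\<close> with the same factor \<open>c\<close>.\<close>
  have "Ck_on k S (\<lambda>x. frechet_derivative h (at x) v)" for v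
  proof (rule Suc.IH)
    show "Ck_on k S (\<lambda>x. frechet_derivative f (at x) v)"
      using Suc.prems(1) by simp
    show "frechet_derivative h (at x) v = c *\<^sub>R frechet_derivative f (at x) v"
      if "x \<in> S" for x
      using frechet_derivative_at[OF deriv[OF that]] by metis
  qed
  moreover have "h differentiable (at x)" if "x \<in> S" for x
    using deriv[OF that] by (rule differentiableI)
  ultimately show ?case
    by simp
qed

text \<open>Provides smoothness of the coefficients \<open>a\<close> and \<open>b\<close>. In a
  chart, a constant factor commutes with composition by the inverse chart, and chart images are
  open.\<close>

lemma smooth_functions_cmult:
  assumes "smooth_manifold A" and "f \<in> smooth_functions A"
  shows "(\<lambda>p. c * f p) \<in> smooth_functions A"
proof -
  have "smooth_on (\<phi> ` U) ((\<lambda>p. c * f p) \<circ> inv_into U \<phi>)" if "(U, \<phi>) \<in> A" for U \<phi>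
  proof -
    have "open (\<phi> ` U)"
      using assms(1) that unfolding smooth_manifold_def by blast
    moreover have "smooth_on (\<phi> ` U) (f \<circ> inv_into U \<phi>)"
      using assms(2) that unfolding smooth_functions_def by blast
    ultimately show ?thesis
      unfolding smooth_on_def by (auto intro: Ck_on_scaleR_cong[where c = c])
  qed
  then show ?thesis
    unfolding smooth_functions_def by blast
qed

theorem theorem3p3:
  fixes A :: "('a::{t2_space, second_countable_topology}, 'n::finite) atlas"
    and g :: "'a tensor02"
  assumes "CARD('n) \<ge> 3"
    and "semi_riemannian_manifold A g"
    and "nearly_quasi_einstein A g"
    and "conharmonically_flat A g"
  shows "nearly_quasi_constant_curvature A g"
proof -
  define c where "c = 1 / (real CARD('n) - 2)"
  obtain \<alpha> \<beta> D where smooth: "\<alpha> \<in> smooth_functions A" "\<beta> \<in> smooth_functions A"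
    and D: "symmetric_tensor_field A D" "nonzero_tensor A D"
    and S: "\<And>X Y p. X \<in> vector_fields A \<Longrightarrow> Y \<in> vector_fields A \<Longrightarrow>
              ricci A g X Y p = \<alpha> p * g X Y p + \<beta> p * D X Y p"
    using assms(3) unfolding nearly_quasi_einstein_def by blast
  have "smooth_manifold A"
    using assms(2) unfolding semi_riemannian_manifold_def by blast
  then have ab: "(\<lambda>p. 2 * c * \<alpha> p) \<in> smooth_functions A" "(\<lambda>p. c * \<beta> p) \<in> smooth_functions A"
    using smooth by (simp_all only: smooth_functions_cmult)
  have "riemann04 A g X Y Z W p =
      2 * c * \<alpha> p * (g Y Z p * g X W p - g X Z p * g Y W p) +
      c * \<beta> p * (g X W p * D Y Z p - g X Z p * D Y W p + g Y Z p * D X W p - g Y W p * D X Z p)"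
    if "X \<in> vector_fields A" "Y \<in> vector_fields A" "Z \<in> vector_fields A" "W \<in> vector_fields A"
    for X Y Z W p
  proof -
    have "conharmonic A g X Y Z W p = 0"
      using assms(4) that unfolding conharmonically_flat_def by blast
    then have "riemann04 A g X Y Z W p =
        c * (g X W p * ricci A g Y Z p - g X Z p * ricci A g Y W p +
             g Y Z p * ricci A g X W p - g Y W p * ricci A g X Z p)"
      unfolding conharmonic_def c_def by linarith
    \<comment> \<open>Under \<open>S\<close> the first and third \<open>g\<close>-terms coincide, as
      do the second and fourth; hence the factor 2.\<close>
    then show ?thesis
      using that by (simp add: S algebra_simps)
  qed
  then show ?thesis
    unfolding nearly_quasi_constant_curvature_def
    \<comment> \<open>\<open>D\<close> brings its symmetry and nonvanishing from the nearly
      quasi-Einstein condition.\<close>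
    by (intro conjI bexI[OF _ ab(1)] bexI[OF _ ab(2)] exI[of _ D] assms(2) D ballI allI)
qed

end
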